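(* Let $j\in\{1,2,3\}$ and let $(\underline{\hat x},\underline{\hat u})=((\hat x_t)_{t\in\mathbb N},(\hat u_t)_{t\in\mathbb N})$ be a solution of problem $(P^j_i)$ (defined in the context). Assume: (i) For all $t\in\mathbb N$, $\hat u_t\in \operatorname{int} U_t$ (topological interior in $\mathbb R^d$). (ii) For all $t\in\mathbb N$, $\phi_t$ and $f_t$ are Gâteaux differentiable at $(\hat x_t,\hat u_t)$. (iii) For all $t\in\mathbb N$ and all $\alpha\in\{1,\dots,n\}$, the coordinate function $f_t^\alpha$ is lower semicontinuous at $(\hat x_t,\hat u_t)$ whenever $f_t^\alpha(\hat x_t,\hat u_t)>\hat x_{t+1}^\alpha$. (iv) For all $t\in\mathbb N$, the partial Gâteaux differential $D_{G,1}f_t(\hat x_t,\hat u_t)$ is invertible. Then there exist $\lambda_0\in\mathbb R$ and $(p_t)_{t\in\mathbb N_*}\in(\mathbb R^{n*})^{\mathbb N_*}$ such that: (NN) $(\lambda_0,p_1)\neq(0,0)$. (Si) $\lambda_0\ge 0$ and $p_t\ge 0$ for all $t\in\mathbb N_*$. (S$\ell$) For all $t\in\mathbb N$ and all $\alpha\in\{1,\dots,n\}$, $p_{t+1}^\alpha\cdot(f_t^\alpha(\hat x_t,\hat u_t)-\hat x_{t+1}^\alpha)=0$. (AE) For all $t\in\mathbb N_*$, $p_t=p_{t+1}\circ D_{G,1}f_t(\hat x_t,\hat u_t)+\lambda_0 D_{G,1}\phi_t(\hat x_t,\hat u_t)$. (WM) For all $t\in\mathbb N$, $p_{t+1}\circ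 D_{G,2}f_t(\hat x_t,\hat u_t)+\lambda_0D_{G,2}\phi_t(\hat x_t,\hat u_t)=0$.
   Context: $\mathbb N=\{0,1,2,\dots\}$, $\mathbb N_*=\mathbb N\setminus\{0\}$. For each $t\in\mathbb N$, $X_t$ is a nonempty open subset of $\mathbb R^n$, $U_t$ is a nonempty subset of $\mathbb R^d$, $f_t:X_t\times U_t\to X_{t+1}$ is a mapping with coordinates $f_t^\alpha$, $1\le\alpha\le n$, and $\phi_t:X_t\times U_t\to\mathbb R$ is a function. A point $\sigma\in X_0$ is fixed. The order on $\mathbb R^n$ is coordinatewise: $x\le y$ iff $x^\alpha\le y^\alpha$ for all $\alpha$. $\mathbb R^{n*}$ is the dual of $\mathbb R^n$; $p\in\mathbb R^{n*}$ has coordinates $p^\alpha$ in the canonical dual basis and $p\ge 0$ means $p^\alpha\ge0$ for all $\alpha$. $\mathrm{Adm}_i$ is the set of $(\underline x,\underline u)=((x_t)_{t\in\mathbb N},(u_t)_{t\in\mathbb N})\in\prod_{t\in\mathbb N}X_t\times\prod_{t\in\mathbb N}U_t$ such that $x_0=\sigma$ and $x_{t+1}\le f_t(x_t,u_t)$ for all $t\in\mathbb N$. $\mathrm{Dom}_i$ is the set of $(\underline x,\underline u)\in\mathrm{Adm}_i$ such that the series $\sum_{t=0}^{+\infty}\phi_t(x_t,u_t)$ converges in $\mathbb R$, and $J(\underline x,\underline u):=\sum_{t=0}^{+\infty}\phi_t(x_t,u_t)$ on $\mathrm{Dom}_i$. The problems are: $(P^1_i)$: maximize $J(\underline x,\underline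 u)$ over $(\underline x,\underline u)\in\mathrm{Dom}_i$. $(P^2_i)$: find $(\underline{\hat x},\underline{\hat u})\in\mathrm{Adm}_i$ such that for all $(\underline x,\underline u)\in\mathrm{Adm}_i$, $\limsup_{h\to+\infty}\left(\sum_{t=0}^h\phi_t(\hat x_t,\hat u_t)-\sum_{t=0}^h\phi_t(x_t,u_t)\right)\ge0$. $(P^3_i)$: the same with $\liminf$ in place of $\limsup$. Gâteaux differentiability: for finite-dimensional real normed spaces $E,F$, $A\subset E$, $\Phi:A\to F$ and $a\in A$, $\Phi$ is Gâteaux differentiable at $a$ when for all $v\in E$ the limit $\vec D\Phi(a,v):=\lim_{s\to0}\frac1s(\Phi(a+sv)-\Phi(a))$ exists and $v\mapsto\vec D\Phi(a,v)$ is linear; then $D_G\Phi(a)v:=\vec D\Phi(a,v)$. If $E=E_1\times E_2$ and $a=(a_1,a_2)$, $D_{G,1}\Phi(a)$ (resp. $D_{G,2}\Phi(a)$) is the Gâteaux differential of $\Phi(\cdot,a_2)$ at $a_1$ (resp. of $\Phi(a_1,\cdot)$ at $a_2$). *)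

theory Defs
  imports "HOL-Analysis.Analysis"
begin

definition gateaux_dir :: "('a::real_normed_vector \<Rightarrow> 'b::real_normed_vector) \<Rightarrow> 'a \<Rightarrow> 'a \<Rightarrow> 'b" where
  "gateaux_dir \<Phi> a v = Lim (at 0) (\<lambda>s::real. (\<Phi> (a + s *\<^sub>R v) - \<Phi> a) /\<^sub>R s)"

text \<open>
  Functions with domain \<open>A\<close> are total functions in HOL. For the two-sided limit to make sense,
  \<open>a + s *\<^sub>R v\<close> has to lie in \<open>A\<close> for all small \<open>s\<close>; this is part of differentiability on \<open>A\<close> and
  makes the limit independent of the values of \<open>\<Phi>\<close> outside \<open>A\<close>. It holds whenever \<open>a\<close> is an
  interior point of \<open>A\<close>.
\<close>

definition gateaux_differentiable_on_at ::
    "'a set \<Rightarrow> ('a::real_normed_vector \<Rightarrow> 'b::real_normed_vector) \<Rightarrow> 'a \<Rightarrow> bool" where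
  "gateaux_differentiable_on_at A \<Phi> a \<longleftrightarrow>
     a \<in> A \<and>
     (\<forall>v. (\<forall>\<^sub>F s::real in at 0. a + s *\<^sub>R v \<in> A) \<and>
          (\<exists>l. ((\<lambda>s::real. (\<Phi> (a + s *\<^sub>R v) - \<Phi> a) /\<^sub>R s) \<longlongrightarrow> l) (at 0))) \<and>
     linear (gateaux_dir \<Phi> a)"

text \<open>The Gateaux differential \<open>D\<^sub>G \<Phi>(a)\<close>; meaningful only at points of differentiability.\<close>

definition gateaux_deriv :: "('a::real_normed_vector \<Rightarrow> 'b::real_normed_vector) \<Rightarrow> 'a \<Rightarrow> 'a \<Rightarrow> 'b" where
  "gateaux_deriv \<Phi> a = gateaux_dir \<Phi> a"

definition gateaux_deriv1 ::
    "('a::real_normed_vector \<times> 'b::real_normed_vector \<Rightarrow> 'c::real_normed_vector) \<Rightarrow> 'a \<times> 'b \<Rightarrow> 'a \<Rightarrow> 'c" where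
  "gateaux_deriv1 \<Phi> a = gateaux_deriv (\<lambda>x. \<Phi> (x, snd a)) (fst a)"

definition gateaux_deriv2 ::
    "('a::real_normed_vector \<times> 'b::real_normed_vector \<Rightarrow> 'c::real_normed_vector) \<Rightarrow> 'a \<times> 'b \<Rightarrow> 'b \<Rightarrow> 'c" where
  "gateaux_deriv2 \<Phi> a = gateaux_deriv (\<lambda>y. \<Phi> (fst a, y)) (snd a)"

text \<open>Lower semicontinuity at \<open>a\<close> of the restriction of \<open>g\<close> to \<open>A\<close>.\<close>

definition lsc_at_within :: "('a::topological_space \<Rightarrow> real) \<Rightarrow> 'a \<Rightarrow> 'a set \<Rightarrow> bool" where
  "lsc_at_within g a A \<longleftrightarrow> (\<forall>c < g a. \<forall>\<^sub>F z in at a within A. c < g z)"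

text \<open>The dual of \<open>\<real>\<^sup>n\<close> is the type \<open>(real^'n) \<Rightarrow>\<^sub>L real\<close>.\<close>

definition dual_coord :: "((real^'n) \<Rightarrow>\<^sub>L real) \<Rightarrow> 'n \<Rightarrow> real" where
  "dual_coord p \<alpha> = blinfun_apply p (axis \<alpha> 1)"

definition dual_nonneg :: "((real^'n) \<Rightarrow>\<^sub>L real) \<Rightarrow> bool" where
  "dual_nonneg p \<longleftrightarrow> (\<forall>\<alpha>. 0 \<le> dual_coord p \<alpha>)"

text \<open>On \<^typ>\<open>real^'n\<close> the library order \<open>\<le>\<close> is the coordinatewise one.\<close>

definition Adm ::
    "(nat \<Rightarrow> (real^'n) set) \<Rightarrow> (nat \<Rightarrow> (real^'d) set) \<Rightarrow> (nat \<Rightarrow> (real^'n) \<times> (real^'d) \<Rightarrow> real^'n)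
      \<Rightarrow> real^'n \<Rightarrow> ((nat \<Rightarrow> real^'n) \<times> (nat \<Rightarrow> real^'d)) set" where
  "Adm X U f \<sigma> = {(x, u). (\<forall>t. x t \<in> X t) \<and> (\<forall>t. u t \<in> U t) \<and> x 0 = \<sigma> \<and>
                          (\<forall>t. x (t + 1) \<le> f t (x t, u t))}"

definition Dom ::
    "(nat \<Rightarrow> (real^'n) set) \<Rightarrow> (nat \<Rightarrow> (real^'d) set) \<Rightarrow> (nat \<Rightarrow> (real^'n) \<times> (real^'d) \<Rightarrow> real^'n)
      \<Rightarrow> (nat \<Rightarrow> (real^'n) \<times> (real^'d) \<Rightarrow> real) \<Rightarrow> real^'n
      \<Rightarrow> ((nat \<Rightarrow> real^'n) \<times> (nat \<Rightarrow> real^'d)) set" where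
  "Dom X U f \<phi> \<sigma> = {(x, u) \<in> Adm X U f \<sigma>. summable (\<lambda>t. \<phi> t (x t, u t))}"

definition J ::
    "(nat \<Rightarrow> (real^'n) \<times> (real^'d) \<Rightarrow> real) \<Rightarrow> (nat \<Rightarrow> real^'n) \<Rightarrow> (nat \<Rightarrow> real^'d) \<Rightarrow> real" where
  "J \<phi> x u = (\<Sum>t. \<phi> t (x t, u t))"

definition solves_P1 ::
    "(nat \<Rightarrow> (real^'n) set) \<Rightarrow> (nat \<Rightarrow> (real^'d) set) \<Rightarrow> (nat \<Rightarrow> (real^'n) \<times> (real^'d) \<Rightarrow> real^'n)
      \<Rightarrow> (nat \<Rightarrow> (real^'n) \<times> (real^'d) \<Rightarrow> real) \<Rightarrow> real^'n
      \<Rightarrow> (nat \<Rightarrow> real^'n) \<Rightarrow> (nat \<Rightarrow> real^'d) \<Rightarrow> bool" where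
  "solves_P1 X U f \<phi> \<sigma> xh uh \<longleftrightarrow>
     (xh, uh) \<in> Dom X U f \<phi> \<sigma> \<and> (\<forall>(x, u) \<in> Dom X U f \<phi> \<sigma>. J \<phi> x u \<le> J \<phi> xh uh)"

definition solves_P2 ::
    "(nat \<Rightarrow> (real^'n) set) \<Rightarrow> (nat \<Rightarrow> (real^'d) set) \<Rightarrow> (nat \<Rightarrow> (real^'n) \<times> (real^'d) \<Rightarrow> real^'n)
      \<Rightarrow> (nat \<Rightarrow> (real^'n) \<times> (real^'d) \<Rightarrow> real) \<Rightarrow> real^'n
      \<Rightarrow> (nat \<Rightarrow> real^'n) \<Rightarrow> (nat \<Rightarrow> real^'d) \<Rightarrow> bool" where
  "solves_P2 X U f \<phi> \<sigma> xh uh \<longleftrightarrow>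
     (xh, uh) \<in> Adm X U f \<sigma> \<and>
     (\<forall>(x, u) \<in> Adm X U f \<sigma>.
        0 \<le> limsup (\<lambda>h. ereal ((\<Sum>t=0..h. \<phi> t (xh t, uh t)) - (\<Sum>t=0..h. \<phi> t (x t, u t)))))"

definition solves_P3 ::
    "(nat \<Rightarrow> (real^'n) set) \<Rightarrow> (nat \<Rightarrow> (real^'d) set) \<Rightarrow> (nat \<Rightarrow> (real^'n) \<times> (real^'d) \<Rightarrow> real^'n)
      \<Rightarrow> (nat \<Rightarrow> (real^'n) \<times> (real^'d) \<Rightarrow> real) \<Rightarrow> real^'n
      \<Rightarrow> (nat \<Rightarrow> real^'n) \<Rightarrow> (nat \<Rightarrow> real^'d) \<Rightarrow> bool" where
  "solves_P3 X U f \<phi> \<sigma> xh uh \<longleftrightarrow>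
     (xh, uh) \<in> Adm X U f \<sigma> \<and>
     (\<forall>(x, u) \<in> Adm X U f \<sigma>.
        0 \<le> liminf (\<lambda>h. ereal ((\<Sum>t=0..h. \<phi> t (xh t, uh t)) - (\<Sum>t=0..h. \<phi> t (x t, u t)))))"

end

theory Submission
  imports Defs
begin

text \<open>
  A process perturbed at finitely many times only changes finitely many terms of the objective, and
  Gateaux differentiability makes all data continuous along each ray. Hence no finitely supported
  direction can strictly increase the objective to first order while strictly satisfying every
  linearized active constraint.

  The multipliers are obtained without any finite-horizon limit: the pairs (objective gain, slack of
  the first constraint) attainable by finitely supported linearized variations form a convex cone in
  the fixed space \<open>\<real> \<times> \<real>\<^sup>n\<close>, an increasing union over the horizon. If it were the whole space, some
  finite horizon would already give the whole space, and adding a strictly feasible variation (which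
  exists because the partial differentials in the state are onto) would produce a forbidden strict
  direction. So the cone has a nonzero polar vector, which is \<open>(\<lambda>\<^sub>0, p\<^sub>1)\<close>. The adjoint equation,
  solved forward by inverting the partial differentials, defines the other \<open>p\<^sub>t\<close>; testing the polar
  inequality on variations propagated backward from time \<open>t\<close> gives their sign, the complementary
  slackness and the weak maximum principle.
\<close>

section \<open>Convex cones in Euclidean spaces\<close>

text \<open>A hyperplane separates a missed point \<open>z\<close> from the cone. The cone contains
  all nonnegative multiples of its points, so a linear lower bound on it can only be the bound
  0.\<close>

lemma convex_cone_polar_nonzero:
  fixes K :: "'a::euclidean_space set"
  assumes K: "convex_cone K" and "K \<noteq> UNIV"
  obtains q where "q \<noteq> 0" and "\<And>k. k \<in> K \<Longrightarrow> q \<bullet> k \<le> 0"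
proof -
  obtain z where z: "z \<notin> K" using \<open>K \<noteq> UNIV\<close> by blast
  have "convex ((\<lambda>k. - z + k) ` K)"
    using K unfolding convex_cone_def by (intro convex_translation) blast
  moreover have "0 \<notin> (\<lambda>k. - z + k) ` K"
  proof
    assume "0 \<in> (\<lambda>k. - z + k) ` K"
    then obtain k where "k \<in> K" "0 = - z + k" by blast
    then have "k = z" by (metis add_eq_0_iff minus_minus)
    with z \<open>k \<in> K\<close> show False by simp
  qed
  ultimately obtain a where "a \<noteq> 0" and a: "\<forall>x\<in>(\<lambda>k. - z + k) ` K. 0 \<le> a \<bullet> x"
    by (metis separating_hyperplane_set_0)
  have "0 \<le> a \<bullet> k" if "k \<in> K" for k
  proof (rule ccontr)
    assume neg: "\<not> 0 \<le> a \<bullet> k"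
    \<comment> \<open>This scaling makes \<open>c * (a \<bullet> k)\<close> equal to
      \<open>- (\<bar>a \<bullet> z\<bar> + 1)\<close>, which lies below
      \<open>a \<bullet> z\<close>.\<close>
    define c where "c = (\<bar>a \<bullet> z\<bar> + 1) / (- (a \<bullet> k))"
    have "c \<ge> 0" unfolding c_def using neg by (intro divide_nonneg_nonneg) linarith+
    then have "c *\<^sub>R k \<in> K" using K that by (simp add: convex_cone_scaleR)
    with a have "0 \<le> a \<bullet> (- z + c *\<^sub>R k)" by blast
    then have "a \<bullet> z \<le> c * (a \<bullet> k)" by (simp add: inner_diff_right)
    moreover have "c * (a \<bullet> k) = - (\<bar>a \<bullet> z\<bar> + 1)" using neg by (simp add: c_def)
    ultimately show False by linarith
  qed
  then have "- a \<bullet> k \<le> 0" if "k \<in> K" for k using that by (simp add: inner_minus_left)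
  moreover have "- a \<noteq> 0" using \<open>a \<noteq> 0\<close> by simp
  ultimately show thesis by (rule that[rotated])
qed

text \<open>The basis vectors and their negatives generate the whole space as a cone. Each of these
  finitely many vectors lies in some \<open>K T\<close>, and monotonicity puts them all into a
  single one.\<close>

lemma incseq_convex_cones_UNIV:
  fixes K :: "nat \<Rightarrow> 'a::euclidean_space set"
  assumes K: "\<And>T. convex_cone (K T)" and mono: "incseq K" and UN: "(\<Union>T. K T) = UNIV"
  obtains T where "K T = UNIV"
proof -
  have ev: "\<forall>\<^sub>F T in sequentially. x \<in> K T" for x
  proof -
    obtain T0 where "x \<in> K T0" using UN by blast
    then show ?thesis using mono by (auto simp: eventually_sequentially incseq_def)
  qed
  have "\<forall>\<^sub>F T in sequentially. \<forall>b\<in>Basis. b \<in> K T \<and> - b \<in> K T"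
    by (intro eventually_ball_finite ballI eventually_conj ev) auto
  then obtain T where T: "\<And>b. b \<in> Basis \<Longrightarrow> b \<in> K T \<and> - b \<in> K T"
    by (auto simp: eventually_sequentially)
  have "x \<in> K T" for x
  proof -
    have "(x \<bullet> b) *\<^sub>R b \<in> K T" if "b \<in> Basis" for b
    proof (cases "x \<bullet> b \<ge> 0")
      case True
      then show ?thesis using T[OF that] K by (intro convex_cone_scaleR) simp_all
    next
      case False
      then have "(- (x \<bullet> b)) *\<^sub>R (- b) \<in> K T"
        using T[OF that] K by (intro convex_cone_scaleR) auto
      then show ?thesis by simp
    qed
    moreover have "(\<Sum>b\<in>B. g b) \<in> K T"
      if "finite B" "\<And>b. b \<in> B \<Longrightarrow> g b \<in> K T" for B and g :: "'a \<Rightarrow> 'a"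
      using that
    proof (induction B)
      case empty
      show ?case using convex_cone_contains_0[OF K] by simp
    next
      case (insert b B)
      then show ?case using convex_cone_add[OF K] by simp
    qed
    ultimately have "(\<Sum>b\<in>Basis. (x \<bullet> b) *\<^sub>R b) \<in> K T" by simp
    then show ?thesis by (simp add: euclidean_representation)
  qed
  then show thesis using that by blast
qed

text \<open>Solve backward from the value 0 after time \<open>T\<close>, taking a preimage at each
  step. With \<open>e = 1\<close> this gives states that meet the linearized constraints up to
  \<open>T\<close> with slack 1.\<close>

lemma surj_backward_orbit:
  fixes G :: "nat \<Rightarrow> 'a::monoid_add \<Rightarrow> 'a"
  assumes "\<And>t. surj (G t)"
  shows "\<exists>x. (\<forall>s>T. x s = 0) \<and> (\<forall>t\<le>T. G t (x t) = x (Suc t) + e)"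
  using assms
proof (induction T arbitrary: G)
  case 0
  obtain a where "e = G 0 a" using surjD[OF "0.prems"] by blast
  then show ?case
    by (intro exI[of _ "\<lambda>s. if s = 0 then a else 0"]) auto
next
  case (Suc T)
  \<comment> \<open>The part from time 1 on is an orbit of the shifted maps; only the value at time
    0 remains to be chosen.\<close>
  obtain x where x: "\<forall>s>T. x s = 0" "\<forall>t\<le>T. G (Suc t) (x t) = x (Suc t) + e"
    using Suc.IH[of "\<lambda>t. G (Suc t)"] Suc.prems by blast
  obtain a where "x 0 + e = G 0 a" using surjD[OF Suc.prems] by blast
  show ?case
  proof (intro exI[of _ "case_nat a x"] conjI allI impI)
    show "case_nat a x s = 0" if "s > Suc T" for s
      using that x by (cases s) auto
    show "G t (case_nat a x t) = case_nat a x (Suc t) + e" if "t \<le> Suc T" for t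
      using that x \<open>x 0 + e = G 0 a\<close> by (cases t) auto
  qed
qed

section \<open>Variations of a linear control process\<close>

text \<open>
  \<open>A t\<close> and \<open>\<Phi> t\<close> are the differentials of \<open>f\<^sub>t\<close> and \<open>\<phi>\<^sub>t\<close> at the optimal pair, \<open>act t\<close> the set of
  coordinates in which the constraint \<open>x\<^sub>t\<^sub>+\<^sub>1 \<le> f\<^sub>t(x\<^sub>t, u\<^sub>t)\<close> is an equality there.
\<close>

locale linear_process =
  fixes A :: "nat \<Rightarrow> (real^'n) \<times> 'u::real_vector \<Rightarrow> real^'n"
    and \<Phi> :: "nat \<Rightarrow> (real^'n) \<times> 'u \<Rightarrow> real"
    and act :: "nat \<Rightarrow> 'n set"
  assumes linear_A: "linear (A t)"
    and linear_\<Phi>: "linear (\<Phi> t)"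
begin

lemma A_simps:
  "A t (x + x', u + u') = A t (x, u) + A t (x', u')"
  "A t (c *\<^sub>R x, c *\<^sub>R u) = c *\<^sub>R A t (x, u)"
  "A t (0, 0) = 0"
  using linear_add[OF linear_A, of t "(x, u)" "(x', u')"] linear_scale[OF linear_A, of t c "(x, u)"]
    linear_0[OF linear_A, of t]
  by (auto simp: zero_prod_def)

lemma \<Phi>_simps:
  "\<Phi> t (x + x', u + u') = \<Phi> t (x, u) + \<Phi> t (x', u')"
  "\<Phi> t (c *\<^sub>R x, c *\<^sub>R u) = c * \<Phi> t (x, u)"
  "\<Phi> t (0, 0) = 0"
  using linear_add[OF linear_\<Phi>, of t "(x, u)" "(x', u')"] linear_scale[OF linear_\<Phi>, of t c "(x, u)"]
    linear_0[OF linear_\<Phi>, of t]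
  by (auto simp: zero_prod_def)

definition gain :: "nat \<Rightarrow> (nat \<Rightarrow> real^'n) \<Rightarrow> (nat \<Rightarrow> 'u) \<Rightarrow> real" where
  "gain T dx du = (\<Sum>s\<le>T. \<Phi> s (dx s, du s))"

text \<open>The vector \<open>y\<close> tightens the first constraint. The constraints are imposed
  at all times; beyond \<open>T\<close> they read 0 \<le> 0, so a variation stays one when
  \<open>T\<close> grows.\<close>

definition variation :: "nat \<Rightarrow> (nat \<Rightarrow> real^'n) \<Rightarrow> (nat \<Rightarrow> 'u) \<Rightarrow> real^'n \<Rightarrow> bool" where
  "variation T dx du y \<longleftrightarrow> dx 0 = 0 \<and> (\<forall>s>T. dx s = 0 \<and> du s = 0) \<and>
     (\<forall>s. \<forall>\<alpha>\<in>act s. dx (Suc s) $ \<alpha> + (if s = 0 then y $ \<alpha> else 0) \<le> A s (dx s, du s) $ \<alpha>)"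

text \<open>Allowing \<open>c\<close> below the gain makes the set downward closed in its first
  component, which forces the multiplier of the objective to be nonnegative.\<close>

definition reach :: "nat \<Rightarrow> (real \<times> (real^'n)) set" where
  "reach T = {(c, y). \<exists>dx du. variation T dx du y \<and> c \<le> gain T dx du}"

lemma gain_add: "gain T (\<lambda>s. dx s + dx' s) (\<lambda>s. du s + du' s) = gain T dx du + gain T dx' du'"
  by (simp add: gain_def \<Phi>_simps sum.distrib)

lemma gain_scale: "gain T (\<lambda>s. c *\<^sub>R dx s) (\<lambda>s. c *\<^sub>R du s) = c * gain T dx du"
  by (simp add: gain_def \<Phi>_simps sum_distrib_left)

lemma variation_add:
  assumes "variation T dx du y" "variation T dx' du' y'"
  shows "variation T (\<lambda>s. dx s + dx' s) (\<lambda>s. du s + du' s) (y + y')"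
  unfolding variation_def
proof (intro conjI allI impI ballI)
  fix s \<alpha> assume "\<alpha> \<in> act s"
  with assms have "dx (Suc s) $ \<alpha> + (if s = 0 then y $ \<alpha> else 0) \<le> A s (dx s, du s) $ \<alpha>"
    "dx' (Suc s) $ \<alpha> + (if s = 0 then y' $ \<alpha> else 0) \<le> A s (dx' s, du' s) $ \<alpha>"
    by (auto simp: variation_def)
  then show "(dx (Suc s) + dx' (Suc s)) $ \<alpha> + (if s = 0 then (y + y') $ \<alpha> else 0)
      \<le> A s (dx s + dx' s, du s + du' s) $ \<alpha>"
    by (auto simp: A_simps split: if_splits)
qed (use assms in \<open>auto simp: variation_def\<close>)

lemma variation_scale:
  assumes "variation T dx du y" "c \<ge> 0"
  shows "variation T (\<lambda>s. c *\<^sub>R dx s) (\<lambda>s. c *\<^sub>R du s) (c *\<^sub>R y)"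
  unfolding variation_def
proof (intro conjI allI impI ballI)
  fix s \<alpha> assume "\<alpha> \<in> act s"
  with assms have "dx (Suc s) $ \<alpha> + (if s = 0 then y $ \<alpha> else 0) \<le> A s (dx s, du s) $ \<alpha>"
    by (auto simp: variation_def)
  from mult_left_mono[OF this \<open>c \<ge> 0\<close>]
  show "(c *\<^sub>R dx (Suc s)) $ \<alpha> + (if s = 0 then (c *\<^sub>R y) $ \<alpha> else 0)
      \<le> A s (c *\<^sub>R dx s, c *\<^sub>R du s) $ \<alpha>"
    by (auto simp: A_simps algebra_simps split: if_splits)
qed (use assms in \<open>auto simp: variation_def\<close>)

lemma convex_cone_reach: "convex_cone (reach T)"
  unfolding convex_cone_iff
proof (intro conjI ballI allI impI)
  show "0 \<in> reach T"
    unfolding reach_def zero_prod_def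
    by (auto intro!: exI[of _ "\<lambda>_. 0"] simp: variation_def gain_def A_simps \<Phi>_simps)
next
  fix a b assume "a \<in> reach T" "b \<in> reach T"
  then obtain dx du dx' du' where "variation T dx du (snd a)" "fst a \<le> gain T dx du"
    "variation T dx' du' (snd b)" "fst b \<le> gain T dx' du'"
    by (auto simp: reach_def)
  then have "variation T (\<lambda>s. dx s + dx' s) (\<lambda>s. du s + du' s) (snd (a + b))"
    "fst (a + b) \<le> gain T (\<lambda>s. dx s + dx' s) (\<lambda>s. du s + du' s)"
    by (auto simp: gain_add intro: variation_add)
  then show "a + b \<in> reach T" unfolding reach_def by (cases "a + b") auto
next
  fix a c assume "a \<in> reach T" "0 \<le> (c::real)"
  then obtain dx du where "variation T dx du (snd a)" "fst a \<le> gain T dx du"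
    by (auto simp: reach_def)
  then have "variation T (\<lambda>s. c *\<^sub>R dx s) (\<lambda>s. c *\<^sub>R du s) (snd (c *\<^sub>R a))"
    "fst (c *\<^sub>R a) \<le> gain T (\<lambda>s. c *\<^sub>R dx s) (\<lambda>s. c *\<^sub>R du s)"
    using \<open>0 \<le> c\<close> by (auto simp: gain_scale intro: variation_scale mult_left_mono)
  then show "c *\<^sub>R a \<in> reach T" unfolding reach_def by (cases "c *\<^sub>R a") auto
qed

lemma incseq_reach: "incseq reach"
proof (rule incseq_SucI, clarify)
  fix T c y assume "(c, y) \<in> reach T"
  then obtain dx du where v: "variation T dx du y" "c \<le> gain T dx du"
    by (auto simp: reach_def)
  moreover have "variation (Suc T) dx du y" using v by (auto simp: variation_def)
  moreover have "gain (Suc T) dx du = gain T dx du"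
    using v by (simp add: gain_def variation_def \<Phi>_simps)
  ultimately show "(c, y) \<in> reach (Suc T)" unfolding reach_def by force
qed

section \<open>Multiplier rule for the linear process\<close>

text \<open>Slater-type argument: if every pair of gain and slack were attainable, a strictly
  feasible variation could be added whatever it costs, with a positive gain left over.\<close>

lemma reach_noteq_UNIV:
  assumes surj: "\<And>t. surj (\<lambda>x. A t (x, 0))"
    and no_strict: "\<And>dx du. dx 0 = 0 \<Longrightarrow> (\<And>s. s > T \<Longrightarrow> dx s = 0 \<and> du s = 0) \<Longrightarrow>
      (\<And>t \<alpha>. t \<le> T \<Longrightarrow> \<alpha> \<in> act t \<Longrightarrow> dx (Suc t) $ \<alpha> < A t (dx t, du t) $ \<alpha>) \<Longrightarrow> gain T dx du \<le> 0"
  shows "reach T \<noteq> UNIV"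
proof
  assume UNIV: "reach T = UNIV"
  obtain z where z: "\<forall>s>T. z s = 0" "\<forall>t\<le>T. A t (z t, 0) = z (Suc t) + 1"
    using surj_backward_orbit[of "\<lambda>t x. A t (x, 0)", OF surj] by blast
  \<comment> \<open>The initial state is fixed, so \<open>z 0\<close> is erased, which loses the
    constraint of \<open>z\<close> at time 0. The slack \<open>1 + z 1\<close> requested below makes
    up for it: \<open>z 1\<close> covers the next state and 1 gives strictness. The requested gain
    leaves a total of at least 1.\<close>
  define dz where "dz = z(0 := 0)"
  have "(1 - gain T dz (\<lambda>_. 0), 1 + z 1) \<in> reach T" using UNIV by simp
  then obtain dx du where v: "variation T dx du (1 + z 1)" and g: "1 - gain T dz (\<lambda>_. 0) \<le> gain T dx du"
    by (auto simp: reach_def)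
  have "gain T (\<lambda>s. dx s + dz s) (\<lambda>s. du s + 0) \<le> 0"
  proof (rule no_strict)
    show "dx 0 + dz 0 = 0" using v by (simp add: variation_def dz_def)
    show "dx s + dz s = 0 \<and> du s + 0 = 0" if "s > T" for s
      using v z that by (simp add: variation_def dz_def)
    fix t \<alpha> assume t: "t \<le> T" "\<alpha> \<in> act t"
    then have *: "dx (Suc t) $ \<alpha> + (if t = 0 then (1 + z 1) $ \<alpha> else 0) \<le> A t (dx t, du t) $ \<alpha>"
      using v unfolding variation_def by blast
    show "(dx (Suc t) + dz (Suc t)) $ \<alpha> < A t (dx t + dz t, du t + 0) $ \<alpha>"
      unfolding A_simps using * t z by (cases "t = 0") (auto simp: dz_def A_simps)
  qed
  then show False using g by (simp only: gain_add)
qed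

text \<open>The fourth conclusion combines sign and complementary slackness: \<open>e\<close> is
  free off \<open>act t\<close>, so the coordinates of \<open>p (Suc t)\<close> must vanish
  there.\<close>

theorem multipliers_exist:
  assumes bij: "\<And>t. bij (\<lambda>x. A t (x, 0))"
    and no_strict: "\<And>T dx du. dx 0 = 0 \<Longrightarrow> (\<And>s. s > T \<Longrightarrow> dx s = 0 \<and> du s = 0) \<Longrightarrow>
      (\<And>t \<alpha>. t \<le> T \<Longrightarrow> \<alpha> \<in> act t \<Longrightarrow> dx (Suc t) $ \<alpha> < A t (dx t, du t) $ \<alpha>) \<Longrightarrow> gain T dx du \<le> 0"
  obtains l :: real and p :: "nat \<Rightarrow> real^'n \<Rightarrow> real"
  where "\<And>t. linear (p t)" "l \<noteq> 0 \<or> p 1 \<noteq> (\<lambda>_. 0)" "l \<ge> 0"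
    "\<And>t e. (\<And>\<alpha>. \<alpha> \<in> act t \<Longrightarrow> 0 \<le> e $ \<alpha>) \<Longrightarrow> 0 \<le> p (Suc t) e"
    "\<And>t v. t \<ge> 1 \<Longrightarrow> p t v = p (Suc t) (A t (v, 0)) + l * \<Phi> t (v, 0)"
    "\<And>t w. p (Suc t) (A t (0, w)) + l * \<Phi> t (0, w) = 0"
proof -
  define K where "K = (\<Union>T. reach T)"
  have "convex_cone K"
    unfolding convex_cone_iff
  proof (intro conjI ballI allI impI)
    show "0 \<in> K" using convex_cone_reach convex_cone_contains_0 by (auto simp: K_def)
  next
    fix a b assume "a \<in> K" "b \<in> K"
    then obtain S T where "a \<in> reach S" "b \<in> reach T" by (auto simp: K_def)
    then have "a \<in> reach (max S T)" "b \<in> reach (max S T)"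
      using incseq_reach unfolding incseq_def by (meson max.cobounded1 max.cobounded2 subsetD)+
    then have "a + b \<in> reach (max S T)" by (rule convex_cone_add[OF convex_cone_reach])
    then show "a + b \<in> K" unfolding K_def by blast
  next
    fix a c assume "a \<in> K" "0 \<le> (c::real)"
    then show "c *\<^sub>R a \<in> K" unfolding K_def using convex_cone_scaleR[OF convex_cone_reach] by blast
  qed
  moreover have "K \<noteq> UNIV"
  proof
    assume "K = UNIV"
    then have "(\<Union>T. reach T) = UNIV" by (simp add: K_def)
    then obtain T where "reach T = UNIV"
      by (rule incseq_convex_cones_UNIV[OF convex_cone_reach incseq_reach])
    moreover have "reach T \<noteq> UNIV"
    proof (rule reach_noteq_UNIV)
      show "surj (\<lambda>x. A t (x, 0))" for t using bij by (rule bij_is_surj)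
      show "gain T dx du \<le> 0"
        if "dx 0 = 0" "\<And>s. s > T \<Longrightarrow> dx s = 0 \<and> du s = 0"
          "\<And>t \<alpha>. t \<le> T \<Longrightarrow> \<alpha> \<in> act t \<Longrightarrow> dx (Suc t) $ \<alpha> < A t (dx t, du t) $ \<alpha>" for dx du
        by (rule no_strict) (use that in blast)+
    qed
    ultimately show False by contradiction
  qed
  ultimately obtain q where q: "q \<noteq> 0" "\<And>k. k \<in> K \<Longrightarrow> q \<bullet> k \<le> 0"
    using convex_cone_polar_nonzero by blast
  \<comment> \<open>\<open>l\<close> becomes the multiplier of the objective and \<open>r\<close>
    represents \<open>p 1\<close>.\<close>
  obtain l r where lr: "q = (l, r)" by fastforce
  have polar: "l * gain T dx du + r \<bullet> y \<le> 0" if "variation T dx du y" for T dx du y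
  proof -
    have "(gain T dx du, y) \<in> K" using that by (auto simp: K_def reach_def)
    from q(2)[OF this] show ?thesis by (simp add: lr)
  qed
  \<comment> \<open>The zero variation has gain 0 and therefore reaches -1 as well.\<close>
  have "(- 1, 0) \<in> reach 0"
    unfolding reach_def
    by (auto intro!: exI[of _ "\<lambda>_. 0"] simp: variation_def gain_def A_simps \<Phi>_simps)
  then have "(- 1, 0) \<in> K" by (auto simp: K_def)
  from q(2)[OF this] have l: "l \<ge> 0" by (simp add: lr)

  define B where "B t = inv (\<lambda>x. A t (x, 0))" for t
  have linA0: "linear (\<lambda>x. A t (x, 0))" for t
    by (rule linearI) (use A_simps(1)[where u=0 and u'=0] A_simps(2)[where u=0] in auto)
  have lin\<Phi>0: "linear (\<lambda>x. \<Phi> t (x, 0))" for t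
    by (rule linearI) (use \<Phi>_simps(1)[where u=0 and u'=0] \<Phi>_simps(2)[where u=0] in auto)
  have linB: "linear (B t)" for t
    unfolding B_def by (rule inj_linear_imp_inv_linear[OF linA0 bij_is_inj[OF bij]])
  have AB: "A t (B t v, 0) = v" for t v
    using surj_f_inv_f[OF bij_is_surj[OF bij[of t]], of v] by (simp add: B_def)
  have BA: "B t (A t (v, 0)) = v" for t v
    using inv_f_f[OF bij_is_inj[OF bij[of t]], of v] by (simp add: B_def)

  \<comment> \<open>The adjoint equation solved for the later multiplier. Index \<open>k\<close>
    stands for time \<open>k + 1\<close>, and truncated subtraction gives \<open>p 0\<close> the
    default value \<open>p 1\<close>.\<close>
  define g where "g = rec_nat ((\<bullet>) r) (\<lambda>k h v. h (B (Suc k) v) - l * \<Phi> (Suc k) (B (Suc k) v, 0))"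
  define p where "p t = g (t - 1)" for t
  have p1: "p (Suc 0) = (\<bullet>) r" by (simp add: p_def g_def)
  have pSuc: "p (Suc t) v = p t (B t v) - l * \<Phi> t (B t v, 0)" if "t \<ge> 1" for t v
    using that by (cases t) (auto simp: p_def g_def)
  have ling: "linear (g k)" for k
  proof (induction k)
    case 0
    show ?case by (simp add: g_def bounded_linear.linear[OF bounded_linear_inner_right])
  next
    case (Suc k)
    have "linear (\<lambda>v. g k (B (Suc k) v) - l *\<^sub>R \<Phi> (Suc k) (B (Suc k) v, 0))"
      using linear_compose[OF linB Suc, of "Suc k"] linear_compose[OF linB lin\<Phi>0, of "Suc k" "Suc k"]
      by (intro linear_compose_sub linear_compose_scale_right) (auto simp: o_def)
    then show ?case by (simp add: g_def)
  qed
  then have linp: "linear (p t)" for t by (simp add: p_def)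

  \<comment> \<open>\<open>p t\<close> acts as a price of the state at time \<open>t\<close>. The
    induction carries the polar inequality forward in \<open>t\<close> by extending variations
    backward one step at a time.\<close>
  have backward: "l * (\<Sum>s\<in>{t..T}. \<Phi> s (dx s, du s)) \<le> p t (dx t)"
    if "1 \<le> t" "t \<le> T" "\<And>s. s > T \<Longrightarrow> dx s = 0 \<and> du s = 0"
      "\<And>s \<alpha>. s \<ge> t \<Longrightarrow> \<alpha> \<in> act s \<Longrightarrow> dx (Suc s) $ \<alpha> \<le> A s (dx s, du s) $ \<alpha>" for t T dx du
    using that
  proof (induction t arbitrary: dx du rule: nat_induct_at_least)
    case base
    define dx' du' where "dx' = dx(0 := 0)" and "du' = du(0 := 0)"
    \<comment> \<open>A state \<open>dx 1\<close> is paid for by relaxing the first constraint by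
      exactly that amount, with zero state and control at time 0.\<close>
    have "variation T dx' du' (- dx 1)"
      using base by (auto simp: variation_def dx'_def du'_def A_simps)
    from polar[OF this] have "l * gain T dx' du' \<le> r \<bullet> dx 1" by simp
    moreover have "gain T dx' du' = (\<Sum>s\<in>{1..T}. \<Phi> s (dx s, du s))"
      unfolding gain_def atMost_atLeast0 sum.atLeast_Suc_atMost[OF le0]
      by (simp add: dx'_def du'_def \<Phi>_simps)
    ultimately show ?case by (simp add: p1)
  next
    case (Suc t)
    \<comment> \<open>The prepended state is sent exactly to \<open>dx (Suc t)\<close> under zero
      control, so the constraint at time \<open>t\<close> holds with equality.\<close>
    define dx' du' where "dx' = dx(t := B t (dx (Suc t)))" and "du' = du(t := 0)"
    have "l * (\<Sum>s\<in>{t..T}. \<Phi> s (dx' s, du' s)) \<le> p t (dx' t)"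
    proof (rule Suc.IH)
      fix s \<alpha> assume "t \<le> s" "\<alpha> \<in> act s"
      then show "dx' (Suc s) $ \<alpha> \<le> A s (dx' s, du' s) $ \<alpha>"
        using Suc.prems(3)[of s \<alpha>] by (cases "s = t") (auto simp: dx'_def du'_def AB)
    qed (use Suc.prems in \<open>auto simp: dx'_def du'_def\<close>)
    moreover have "(\<Sum>s\<in>{t..T}. \<Phi> s (dx' s, du' s))
        = \<Phi> t (B t (dx (Suc t)), 0) + (\<Sum>s\<in>{Suc t..T}. \<Phi> s (dx s, du s))"
      using Suc.prems(1) by (subst sum.atLeast_Suc_atMost) (auto simp: dx'_def du'_def)
    ultimately show ?case
      using pSuc[OF Suc.hyps, of "dx (Suc t)"] by (simp add: dx'_def algebra_simps)
  qed

  have AE: "p t v = p (Suc t) (A t (v, 0)) + l * \<Phi> t (v, 0)" if "t \<ge> 1" for t v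
    using pSuc[OF that, of "A t (v, 0)"] by (simp add: BA)
  have key: "p (Suc t) (A t (0, w)) + l * \<Phi> t (0, w) \<le> p (Suc t) e"
    if e: "\<And>\<alpha>. \<alpha> \<in> act t \<Longrightarrow> 0 \<le> e $ \<alpha>" for t w e
  proof (cases "t = 0")
    case True
    \<comment> \<open>At time 0 the state cannot vary; \<open>y\<close> absorbs the effect of the
      control up to the slack \<open>e\<close>.\<close>
    have "variation 0 (\<lambda>_. 0) (\<lambda>s. if s = 0 then w else 0) (A 0 (0, w) - e)"
      using e True by (auto simp: variation_def A_simps)
    from polar[OF this] show ?thesis using True by (simp add: gain_def p1 inner_diff_right)
  next
    case False
    \<comment> \<open>Chosen so that \<open>A t (x, w) = e\<close>, which allows all later states
      and controls to be 0.\<close>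
    define x where "x = B t (e - A t (0, w))"
    have split: "A t (x, w) = A t (x, 0) + A t (0, w)" "\<Phi> t (x, w) = \<Phi> t (x, 0) + \<Phi> t (0, w)"
      using A_simps(1)[of t x 0 0 w] \<Phi>_simps(1)[of t x 0 0 w] by auto
    have Ax: "A t (x, 0) = e - A t (0, w)" by (simp add: x_def AB)
    have "l * (\<Sum>s\<in>{t..t}. \<Phi> s (((\<lambda>_. 0)(t := x)) s, ((\<lambda>_. 0)(t := w)) s)) \<le> p t (((\<lambda>_. 0)(t := x)) t)"
    proof (rule backward)
      fix s \<alpha> assume "t \<le> s" "\<alpha> \<in> act s"
      then show "((\<lambda>_. 0)(t := x)) (Suc s) $ \<alpha> \<le> A s (((\<lambda>_. 0)(t := x)) s, ((\<lambda>_. 0)(t := w)) s) $ \<alpha>"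
        using e by (cases "s = t") (auto simp: A_simps split Ax)
    qed (use False in auto)
    then have "l * \<Phi> t (x, w) \<le> p t x" by simp
    also have "p t x = p (Suc t) e - p (Suc t) (A t (0, w)) + l * \<Phi> t (x, 0)"
      using AE[of t x] False by (simp add: Ax linear_diff[OF linp])
    finally show ?thesis by (simp add: split algebra_simps)
  qed
  show thesis
  proof (rule that[of p l])
    show "l \<noteq> 0 \<or> p 1 \<noteq> (\<lambda>_. 0)"
    proof (rule ccontr)
      assume "\<not> ?thesis"
      then have "l = 0" "\<And>v. r \<bullet> v = 0" by (auto simp: p1 fun_eq_iff)
      then have "q = 0" by (metis inner_eq_zero_iff lr zero_prod_def)
      with q(1) show False by simp
    qed
    show "0 \<le> p (Suc t) e" if "\<And>\<alpha>. \<alpha> \<in> act t \<Longrightarrow> 0 \<le> e $ \<alpha>" for t e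
      using key[OF that, of t 0] by (simp add: A_simps \<Phi>_simps linear_0[OF linp])
    \<comment> \<open>With \<open>e = 0\<close> the inequality \<open>key\<close> holds for both
      \<open>w\<close> and \<open>- w\<close>.\<close>
    show "p (Suc t) (A t (0, w)) + l * \<Phi> t (0, w) = 0" for t w
    proof (rule antisym)
      show "p (Suc t) (A t (0, w)) + l * \<Phi> t (0, w) \<le> 0"
        using key[of t 0 w] by (simp add: linear_0[OF linp])
      have "A t (0, - w) = - A t (0, w)" "\<Phi> t (0, - w) = - \<Phi> t (0, w)"
        using A_simps(2)[of t "- 1" 0 w] \<Phi>_simps(2)[of t "- 1" 0 w] by auto
      then show "0 \<le> p (Suc t) (A t (0, w)) + l * \<Phi> t (0, w)"
        using key[of t 0 "- w"] by (simp add: linear_0[OF linp] linear_neg[OF linp])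
    qed
  qed (fact linp l AE)+
qed

end

section \<open>Gateaux differentials along rays\<close>

lemma gateaux_dir_tendsto:
  assumes "gateaux_differentiable_on_at D F a"
  shows "((\<lambda>s. (F (a + s *\<^sub>R v) - F a) /\<^sub>R s) \<longlongrightarrow> gateaux_dir F a v) (at_right 0)"
proof -
  obtain l where l: "((\<lambda>s. (F (a + s *\<^sub>R v) - F a) /\<^sub>R s) \<longlongrightarrow> l) (at 0)"
    using assms by (auto simp: gateaux_differentiable_on_at_def)
  then have "gateaux_dir F a v = l"
    unfolding gateaux_dir_def by (rule tendsto_Lim[OF trivial_limit_at])
  with l show ?thesis by (auto intro: filterlim_mono at_within_le_at)
qed

text \<open>The increment is \<open>s\<close> times a convergent difference quotient. This keeps
  inactive constraints strict for small steps along a ray.\<close>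

lemma gateaux_radially_continuous:
  assumes "gateaux_differentiable_on_at D F a"
  shows "((\<lambda>s. F (a + s *\<^sub>R v)) \<longlongrightarrow> F a) (at_right 0)"
proof -
  have "((\<lambda>s. F a + s *\<^sub>R ((F (a + s *\<^sub>R v) - F a) /\<^sub>R s)) \<longlongrightarrow> F a + 0 *\<^sub>R gateaux_dir F a v) (at_right 0)"
    by (intro tendsto_intros gateaux_dir_tendsto[OF assms])
  then have "((\<lambda>s. F a + s *\<^sub>R ((F (a + s *\<^sub>R v) - F a) /\<^sub>R s)) \<longlongrightarrow> F a) (at_right 0)" by simp
  then show ?thesis
    by (rule Lim_transform_eventually) (auto simp: eventually_at_filter)
qed

lemma gateaux_deriv1_eq: "gateaux_deriv1 F (x, u) v = gateaux_dir F (x, u) (v, 0)"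
  by (simp add: gateaux_deriv1_def gateaux_deriv_def gateaux_dir_def)

lemma gateaux_deriv2_eq: "gateaux_deriv2 F (x, u) w = gateaux_dir F (x, u) (0, w)"
  by (simp add: gateaux_deriv2_def gateaux_deriv_def gateaux_dir_def)

section \<open>Finite-horizon consequence of optimality\<close>

text \<open>The difference of the partial sums is constant from \<open>T\<close> on, so its limsup
  and liminf are both that constant \<open>d\<close>. For the first problem, changing finitely many
  terms preserves convergence, so the competitor lies in \<open>Dom\<close>.\<close>

lemma solution_finite_horizon:
  assumes sol: "solves_P1 X U f \<phi> \<sigma> xh uh \<or> solves_P2 X U f \<phi> \<sigma> xh uh \<or> solves_P3 X U f \<phi> \<sigma> xh uh"
    and adm: "(x, u) \<in> Adm X U f \<sigma>"
    and tail: "\<And>t. t > T \<Longrightarrow> x t = xh t \<and> u t = uh t"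
  shows "(\<Sum>t\<le>T. \<phi> t (x t, u t)) \<le> (\<Sum>t\<le>T. \<phi> t (xh t, uh t))"
proof -
  define a b where "a = (\<lambda>t. \<phi> t (xh t, uh t))" and "b = (\<lambda>t. \<phi> t (x t, u t))"
  have ab: "b t = a t" if "t > T" for t using tail[OF that] by (simp add: a_def b_def)
  define d where "d = (\<Sum>t\<le>T. a t) - (\<Sum>t\<le>T. b t)"
  have diff: "(\<Sum>t=0..h. a t) - (\<Sum>t=0..h. b t) = d" if "h \<ge> T" for h
    using that
  proof (induction h rule: dec_induct)
    case base
    then show ?case by (simp add: d_def atMost_atLeast0)
  next
    case (step h)
    then show ?case using ab[of "Suc h"] by simp
  qed
  have lim: "(\<lambda>h. ereal ((\<Sum>t=0..h. a t) - (\<Sum>t=0..h. b t))) \<longlonglongrightarrow> ereal d"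
    by (rule tendsto_eventually) (use diff in \<open>auto simp: eventually_sequentially\<close>)
  have "d \<ge> 0"
    using sol
  proof (elim disjE)
    assume P: "solves_P1 X U f \<phi> \<sigma> xh uh"
    then have sa: "summable a" by (auto simp: solves_P1_def Dom_def a_def)
    have "(\<lambda>t. a t - b t) sums (\<Sum>t\<le>T. a t - b t)"
      by (rule sums_finite) (auto simp: ab not_le)
    then have dd: "(\<lambda>t. a t - b t) sums d" by (simp add: d_def sum_subtractf)
    have sb: "b sums (suminf a - d)"
      using sums_diff[OF summable_sums[OF sa] dd] by simp
    then have "(x, u) \<in> Dom X U f \<phi> \<sigma>"
      using adm by (auto simp: Dom_def b_def sums_iff)
    with P have "suminf b \<le> suminf a"
      by (auto simp: solves_P1_def J_def a_def b_def)
    with sb show "d \<ge> 0" by (simp add: sums_iff)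
  next
    assume "solves_P2 X U f \<phi> \<sigma> xh uh"
    with adm lim_imp_Limsup[OF _ lim] show "d \<ge> 0"
      by (auto simp: solves_P2_def a_def b_def)
  next
    assume "solves_P3 X U f \<phi> \<sigma> xh uh"
    with adm lim_imp_Liminf[OF _ lim] show "d \<ge> 0"
      by (auto simp: solves_P3_def a_def b_def)
  qed
  then show ?thesis by (simp add: d_def a_def b_def)
qed

section \<open>Linearization of the control problem at the solution\<close>

theorem theorem3p1:
  fixes X :: "nat \<Rightarrow> (real^'n) set"
    and U :: "nat \<Rightarrow> (real^'d) set"
    and f :: "nat \<Rightarrow> (real^'n) \<times> (real^'d) \<Rightarrow> real^'n"
    and \<phi> :: "nat \<Rightarrow> (real^'n) \<times> (real^'d) \<Rightarrow> real"
    and \<sigma> :: "real^'n"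
    and xh :: "nat \<Rightarrow> real^'n"
    and uh :: "nat \<Rightarrow> real^'d"
  assumes X_open: "\<And>t. open (X t)"
    and X_nonempty: "\<And>t. X t \<noteq> {}"
    and U_nonempty: "\<And>t. U t \<noteq> {}"
    and f_maps: "\<And>t. f t \<in> X t \<times> U t \<rightarrow> X (t + 1)"
    and sigma: "\<sigma> \<in> X 0"
    and solution: "solves_P1 X U f \<phi> \<sigma> xh uh \<or> solves_P2 X U f \<phi> \<sigma> xh uh
                     \<or> solves_P3 X U f \<phi> \<sigma> xh uh"
    and i: "\<And>t. uh t \<in> interior (U t)"
    and ii: "\<And>t. gateaux_differentiable_on_at (X t \<times> U t) (\<phi> t) (xh t, uh t) \<and>
                  gateaux_differentiable_on_at (X t \<times> U t) (f t) (xh t, uh t)"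
    and iii: "\<And>t \<alpha>. f t (xh t, uh t) $ \<alpha> > xh (t + 1) $ \<alpha> \<Longrightarrow>
                lsc_at_within (\<lambda>z. f t z $ \<alpha>) (xh t, uh t) (X t \<times> U t)"
    and iv: "\<And>t. bij (gateaux_deriv1 (f t) (xh t, uh t))"
  shows "\<exists>(lam0::real) (p :: nat \<Rightarrow> (real^'n) \<Rightarrow>\<^sub>L real).
           (lam0, p 1) \<noteq> (0, 0) \<and>
           (lam0 \<ge> 0 \<and> (\<forall>t\<ge>1. dual_nonneg (p t))) \<and>
           (\<forall>t \<alpha>. dual_coord (p (t + 1)) \<alpha> * (f t (xh t, uh t) $ \<alpha> - xh (t + 1) $ \<alpha>) = 0) \<and>
           (\<forall>t\<ge>1. blinfun_apply (p t) =
               (\<lambda>v. blinfun_apply (p (t + 1)) (gateaux_deriv1 (f t) (xh t, uh t) v)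
                  + lam0 * gateaux_deriv1 (\<phi> t) (xh t, uh t) v)) \<and>
           (\<forall>t. (\<lambda>w. blinfun_apply (p (t + 1)) (gateaux_deriv2 (f t) (xh t, uh t) w)
                  + lam0 * gateaux_deriv2 (\<phi> t) (xh t, uh t) w) = (\<lambda>w. 0))"
proof -
  define A where "A t = gateaux_dir (f t) (xh t, uh t)" for t
  define \<Phi> where "\<Phi> t = gateaux_dir (\<phi> t) (xh t, uh t)" for t
  define act where "act t = {\<alpha>. f t (xh t, uh t) $ \<alpha> = xh (Suc t) $ \<alpha>}" for t
  interpret linear_process A \<Phi> act
  proof (rule linear_process.intro)
    show "linear (A t)" "linear (\<Phi> t)" for t
      using ii[of t] unfolding A_def \<Phi>_def gateaux_differentiable_on_at_def by blast+
  qed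
  have adm: "(xh, uh) \<in> Adm X U f \<sigma>"
    using solution by (auto simp: solves_P1_def solves_P2_def solves_P3_def Dom_def)
  have A1: "gateaux_deriv1 (f t) (xh t, uh t) = (\<lambda>v. A t (v, 0))" for t
    by (simp add: A_def gateaux_deriv1_eq fun_eq_iff)

  \<comment> \<open>Otherwise a small step \<open>s\<close> along the direction would give an
    admissible process that beats the solution over the horizon \<open>T\<close>.\<close>
  have no_strict: "gain T dx du \<le> 0"
    if dx0: "dx 0 = 0" and supp: "\<And>s. s > T \<Longrightarrow> dx s = 0 \<and> du s = 0"
      and strict: "\<And>t \<alpha>. t \<le> T \<Longrightarrow> \<alpha> \<in> act t \<Longrightarrow> dx (Suc t) $ \<alpha> < A t (dx t, du t) $ \<alpha>" for T dx du
  proof (rule ccontr)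
    assume "\<not> gain T dx du \<le> 0"
    define z where "z s t = (xh t, uh t) + s *\<^sub>R (dx t, du t)" for s :: real and t
    have "((\<lambda>s. \<Sum>t\<le>T. (\<phi> t (z s t) - \<phi> t (xh t, uh t)) /\<^sub>R s) \<longlongrightarrow> gain T dx du) (at_right 0)"
      unfolding gain_def \<Phi>_def z_def by (intro tendsto_sum gateaux_dir_tendsto) (use ii in blast)
    then have ev_gain: "\<forall>\<^sub>F s in at_right 0. (\<Sum>t\<le>T. (\<phi> t (z s t) - \<phi> t (xh t, uh t)) /\<^sub>R s) > 0"
      using \<open>\<not> gain T dx du \<le> 0\<close> by (intro order_tendstoD(1)) auto
    have ev_dom: "\<forall>\<^sub>F s in at_right 0. z s t \<in> X t \<times> U t" for t
    proof -
      \<comment> \<open>Staying in the domain along each ray is part of the notion of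
        differentiability.\<close>
      have "\<forall>\<^sub>F s in at 0. z s t \<in> X t \<times> U t"
        using ii[of t] unfolding gateaux_differentiable_on_at_def z_def by blast
      then show ?thesis by (rule filter_leD[OF at_within_le_at])
    qed
    have ev_ineq: "\<forall>\<^sub>F s in at_right 0. xh (Suc t) $ \<alpha> + s * dx (Suc t) $ \<alpha> \<le> f t (z s t) $ \<alpha>"
      if "t \<le> T" for t \<alpha>
    proof (cases "\<alpha> \<in> act t")
      case True
      \<comment> \<open>The difference quotient tends to a limit above
        \<open>dx (Suc t) $ \<alpha>\<close>; multiplying by \<open>s > 0\<close> yields the
        constraint, which is an equality at \<open>s = 0\<close>.\<close>
      have "((\<lambda>s. ((f t (z s t) - f t (xh t, uh t)) /\<^sub>R s) $ \<alpha>) \<longlongrightarrow> A t (dx t, du t) $ \<alpha>) (at_right 0)"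
        unfolding A_def z_def by (intro tendsto_vec_nth gateaux_dir_tendsto) (use ii in blast)
      from order_tendstoD(1)[OF this strict[OF that True]] eventually_at_right_less
      show ?thesis
      proof eventually_elim
        case (elim s)
        then have "s * dx (Suc t) $ \<alpha> < f t (z s t) $ \<alpha> - f t (xh t, uh t) $ \<alpha>"
          by (simp add: field_simps)
        then show ?case using True by (simp add: act_def)
      qed
    next
      case False
      then have "xh (Suc t) $ \<alpha> < f t (xh t, uh t) $ \<alpha>"
        using adm by (auto simp: Adm_def act_def less_eq_vec_def order.strict_iff_order)
      moreover have "((\<lambda>s. f t (z s t) $ \<alpha> - s * dx (Suc t) $ \<alpha>) \<longlongrightarrow> f t (xh t, uh t) $ \<alpha> - 0 * dx (Suc t) $ \<alpha>) (at_right 0)"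
        unfolding z_def by (intro tendsto_intros gateaux_radially_continuous) (use ii in blast)
      ultimately have "\<forall>\<^sub>F s in at_right 0. xh (Suc t) $ \<alpha> < f t (z s t) $ \<alpha> - s * dx (Suc t) $ \<alpha>"
        by (intro order_tendstoD(1)) auto
      then show ?thesis by eventually_elim simp
    qed
    \<comment> \<open>Only finitely many times and coordinates occur, so one step size serves them
      all.\<close>
    have "\<forall>\<^sub>F s in at_right 0. (\<forall>t\<in>{..T}. z s t \<in> X t \<times> U t) \<and>
        (\<forall>t\<in>{..T}. \<forall>\<alpha>\<in>UNIV. xh (Suc t) $ \<alpha> + s * dx (Suc t) $ \<alpha> \<le> f t (z s t) $ \<alpha>)"
      by (intro eventually_conj eventually_ball_finite ballI ev_dom ev_ineq) auto
    with ev_gain eventually_at_right_less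
    have "\<forall>\<^sub>F s in at_right 0. (\<Sum>t\<le>T. (\<phi> t (z s t) - \<phi> t (xh t, uh t)) /\<^sub>R s) > 0 \<and> 0 < s \<and>
        (\<forall>t\<in>{..T}. z s t \<in> X t \<times> U t) \<and>
        (\<forall>t\<in>{..T}. \<forall>\<alpha>\<in>UNIV. xh (Suc t) $ \<alpha> + s * dx (Suc t) $ \<alpha> \<le> f t (z s t) $ \<alpha>)"
      by eventually_elim blast
    from eventually_happens'[OF trivial_limit_at_right_real this] obtain s :: real where s: "s > 0"
      and gain_s: "(\<Sum>t\<le>T. (\<phi> t (z s t) - \<phi> t (xh t, uh t)) /\<^sub>R s) > 0"
      and dom_s: "\<And>t. t \<le> T \<Longrightarrow> z s t \<in> X t \<times> U t"
      and ineq_s: "\<And>t \<alpha>. t \<le> T \<Longrightarrow> xh (Suc t) $ \<alpha> + s * dx (Suc t) $ \<alpha> \<le> f t (z s t) $ \<alpha>"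
      by blast
    define x u where "x t = xh t + s *\<^sub>R dx t" and "u t = uh t + s *\<^sub>R du t" for t
    have z: "z s t = (x t, u t)" for t by (simp add: z_def x_def u_def)
    have tail: "x t = xh t \<and> u t = uh t" if "t > T" for t
      using supp[OF that] by (simp add: x_def u_def)
    have "(x, u) \<in> Adm X U f \<sigma>"
    proof -
      have "x t \<in> X t \<and> u t \<in> U t" for t
        using dom_s[of t] tail[of t] adm by (cases "t \<le> T") (auto simp: z Adm_def)
      moreover have "x 0 = \<sigma>" using adm dx0 by (simp add: Adm_def x_def)
      moreover have "x (t + 1) \<le> f t (x t, u t)" for t
      proof (cases "t \<le> T")
        case True
        then show ?thesis using ineq_s[of t] by (auto simp: less_eq_vec_def z x_def)
      next
        case False
        then show ?thesis using tail[of t] tail[of "t + 1"] adm by (auto simp: Adm_def)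
      qed
      ultimately show ?thesis by (auto simp: Adm_def)
    qed
    from solution_finite_horizon[OF solution this tail]
    have "(\<Sum>t\<le>T. \<phi> t (z s t) - \<phi> t (xh t, uh t)) \<le> 0"
      by (simp add: z sum_subtractf)
    moreover have "(\<Sum>t\<le>T. (\<phi> t (z s t) - \<phi> t (xh t, uh t)) /\<^sub>R s)
        = (\<Sum>t\<le>T. \<phi> t (z s t) - \<phi> t (xh t, uh t)) /\<^sub>R s"
      by (rule scaleR_sum_right[symmetric])
    ultimately show False using gain_s s by (simp add: zero_less_mult_iff)
  qed

  show ?thesis
  proof (rule multipliers_exist)
    show "bij (\<lambda>x. A t (x, 0))" for t using iv[of t] by (simp add: A1)
    show "gain T dx du \<le> 0"
      if "dx 0 = 0" "\<And>s. s > T \<Longrightarrow> dx s = 0 \<and> du s = 0"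
        "\<And>t \<alpha>. t \<le> T \<Longrightarrow> \<alpha> \<in> act t \<Longrightarrow> dx (Suc t) $ \<alpha> < A t (dx t, du t) $ \<alpha>" for T dx du
      by (rule no_strict) (use that in blast)+
  next
    fix l :: real and p :: "nat \<Rightarrow> real^'n \<Rightarrow> real"
    assume linp: "\<And>t. linear (p t)"
      and NN: "l \<noteq> 0 \<or> p 1 \<noteq> (\<lambda>_. 0)" and l: "l \<ge> 0"
      and nonneg: "\<And>t e. (\<And>\<alpha>. \<alpha> \<in> act t \<Longrightarrow> 0 \<le> e $ \<alpha>) \<Longrightarrow> 0 \<le> p (Suc t) e"
      and AE: "\<And>t v. t \<ge> 1 \<Longrightarrow> p t v = p (Suc t) (A t (v, 0)) + l * \<Phi> t (v, 0)"
      and WM: "\<And>t w. p (Suc t) (A t (0, w)) + l * \<Phi> t (0, w) = 0"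
    define P where "P t = Blinfun (p t)" for t
    have P: "blinfun_apply (P t) = p t" for t
      using linp[of t] by (simp add: P_def bounded_linear_Blinfun_apply linear_conv_bounded_linear)
    have slack: "p (Suc t) (axis \<alpha> 1) * (f t (xh t, uh t) $ \<alpha> - xh (Suc t) $ \<alpha>) = 0" for t \<alpha>
    proof (cases "\<alpha> \<in> act t")
      case False
      \<comment> \<open>Both vectors vanish on \<open>act t\<close>, so both are allowed as test
        vectors and the coordinate must be 0.\<close>
      then have "0 \<le> p (Suc t) (axis \<alpha> 1)" "0 \<le> p (Suc t) (- axis \<alpha> 1)"
        by (auto intro!: nonneg simp: axis_def)
      then show ?thesis by (simp add: linear_neg[OF linp])
    qed (simp add: act_def)
    have sign: "dual_nonneg (P t)" if "t \<ge> 1" for t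
      using nonneg[of "t - 1"] that by (auto simp: dual_nonneg_def dual_coord_def P axis_def)
    show ?thesis
    proof (intro exI[of _ l] exI[of _ P] conjI allI impI)
      show "(l, P 1) \<noteq> (0, 0)" using NN P[of 1] by (auto simp: fun_eq_iff)
      show "dual_coord (P (t + 1)) \<alpha> * (f t (xh t, uh t) $ \<alpha> - xh (t + 1) $ \<alpha>) = 0" for t \<alpha>
        using slack by (simp add: dual_coord_def P)
      show "blinfun_apply (P t) = (\<lambda>v. blinfun_apply (P (t + 1)) (gateaux_deriv1 (f t) (xh t, uh t) v)
          + l * gateaux_deriv1 (\<phi> t) (xh t, uh t) v)" if "t \<ge> 1" for t
        using AE[OF that] by (auto simp: P gateaux_deriv1_eq A_def \<Phi>_def)
      show "(\<lambda>w. blinfun_apply (P (t + 1)) (gateaux_deriv2 (f t) (xh t, uh t) w)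
          + l * gateaux_deriv2 (\<phi> t) (xh t, uh t) w) = (\<lambda>w. 0)" for t
        using WM by (simp add: P gateaux_deriv2_eq A_def \<Phi>_def)
    qed (use l sign in auto)
  qed
qed

end
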